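(* There is an absolute constant $\varepsilon>0$ such that for every positive integer $n$, $\mathrm{val}(\mathsf{GHZ}^{\otimes n})\leq 2^{-\varepsilon n}$.
   Context: Let $S=\{(x,y,z)\in\{0,1\}^3 : x\oplus y\oplus z=0\}$. In the $n$-fold repeated GHZ game $\mathsf{GHZ}^{\otimes n}$, a verifier samples $(x_i,y_i,z_i)$ independently and uniformly from $S$ for $i=1,\ldots,n$, sends $\vec x=(x_1,\ldots,x_n)$ to Alice, $\vec y=(y_1,\ldots,y_n)$ to Bob and $\vec z=(z_1,\ldots,z_n)$ to Charlie. The players answer according to functions $f,g,h\colon\{0,1\}^n\to\{0,1\}^n$ (answers $f(\vec x)$, $g(\vec y)$, $h(\vec z)$), and the verifier accepts iff $f(\vec x)_i\oplus g(\vec y)_i\oplus h(\vec z)_i = x_i\lor y_i\lor z_i$ for all $i=1,\ldots,n$. The value $\mathrm{val}(\mathsf{GHZ}^{\otimes n})$ is the maximum, over all choices of $f,g,h$, of the acceptance probability. *)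

theory Defs
  imports "HOL-Probability.Probability"
begin

text \<open>Bits are booleans (1 is \<^term>\<open>True\<close>), and exclusive or on bits is \<open>\<noteq>\<close>.\<close>

abbreviation (input) bxor :: "bool \<Rightarrow> bool \<Rightarrow> bool"  (infixl "\<oplus>" 65)
  where "a \<oplus> b \<equiv> a \<noteq> b"

definition ghz_queries :: "(bool \<times> bool \<times> bool) set"
  where "ghz_queries = {(x, y, z). \<not> (x \<oplus> y \<oplus> z)}"

lemma ghz_queries_eq:
  "ghz_queries =
    {(False, False, False), (False, True, True), (True, False, True), (True, True, False)}"
  by (auto simp: ghz_queries_def)

definition ghz_query_pmf :: "nat \<Rightarrow> (bool \<times> bool \<times> bool) list pmf"
  where "ghz_query_pmf n = replicate_pmf n (pmf_of_set ghz_queries)"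

definition cube :: "nat \<Rightarrow> bool list set"
  where "cube n = {xs. length xs = n}"

definition ghz_accepts ::
    "nat \<Rightarrow> (bool list \<Rightarrow> bool list) \<Rightarrow> (bool list \<Rightarrow> bool list) \<Rightarrow> (bool list \<Rightarrow> bool list)
      \<Rightarrow> bool list \<Rightarrow> bool list \<Rightarrow> bool list \<Rightarrow> bool"
  where "ghz_accepts n f g h x y z \<longleftrightarrow>
    (\<forall>i<n. (f x ! i \<oplus> g y ! i \<oplus> h z ! i) = (x ! i \<or> y ! i \<or> z ! i))"

definition ghz_win_prob ::
    "nat \<Rightarrow> (bool list \<Rightarrow> bool list) \<Rightarrow> (bool list \<Rightarrow> bool list) \<Rightarrow> (bool list \<Rightarrow> bool list) \<Rightarrow> real"
  where "ghz_win_prob n f g h =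
    measure_pmf.prob (ghz_query_pmf n)
      {q. ghz_accepts n f g h (map fst q) (map (fst \<circ> snd) q) (map (snd \<circ> snd) q)}"

text \<open>Strategies are extensional functions on the cube, so that there are only finitely many of
  them and the maximum below is a genuine one.\<close>

definition strategies :: "nat \<Rightarrow> (bool list \<Rightarrow> bool list) set"
  where "strategies n = cube n \<rightarrow>\<^sub>E cube n"

definition ghz_value :: "nat \<Rightarrow> real"
  where "ghz_value n =
    Max {ghz_win_prob n f g h | f g h. f \<in> strategies n \<and> g \<in> strategies n \<and> h \<in> strategies n}"

lemma finite_cube: "finite (cube n)"
  using finite_lists_length_eq[of "UNIV :: bool set" n] by (simp add: cube_def)

lemma finite_strategies: "finite (strategies n)"
  unfolding strategies_def by (intro finite_PiE finite_cube)

lemma strategies_nonempty: "strategies n \<noteq> {}"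
proof -
  have "replicate n False \<in> cube n" by (simp add: cube_def)
  then show ?thesis by (auto simp: strategies_def PiE_eq_empty_iff)
qed

lemma ghz_value_attained:
  "\<exists>f\<in>strategies n. \<exists>g\<in>strategies n. \<exists>h\<in>strategies n. ghz_value n = ghz_win_prob n f g h"
  and ghz_win_prob_le_value:
  "\<lbrakk>f \<in> strategies n; g \<in> strategies n; h \<in> strategies n\<rbrakk> \<Longrightarrow> ghz_win_prob n f g h \<le> ghz_value n"
proof -
  let ?P = "{ghz_win_prob n f g h | f g h. f \<in> strategies n \<and> g \<in> strategies n \<and> h \<in> strategies n}"
  have P: "?P = (\<lambda>(f, g, h). ghz_win_prob n f g h) ` (strategies n \<times> strategies n \<times> strategies n)"
    by force
  have fin: "finite ?P"
    unfolding P by (intro finite_imageI finite_cartesian_product finite_strategies)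
  have ne: "?P \<noteq> {}"
    using strategies_nonempty[of n] by blast
  have "ghz_value n \<in> ?P"
    unfolding ghz_value_def using Max_in[OF fin ne] .
  then show "\<exists>f\<in>strategies n. \<exists>g\<in>strategies n. \<exists>h\<in>strategies n.
      ghz_value n = ghz_win_prob n f g h"
    by blast
  show "ghz_win_prob n f g h \<le> ghz_value n"
    if "f \<in> strategies n" "g \<in> strategies n" "h \<in> strategies n"
    unfolding ghz_value_def using that by (intro Max_ge[OF fin]) blast
qed

end

theory Submission
  imports Defs "HOL-Library.Function_Algebras" "HOL-Library.Numeral_Type"
begin

text \<open>Since \<open>x \<or> y \<or> z = (x + y + z) / 2\<close> for \<open>(x, y, z)\<close> in the query set, the players win iff
  the lifts \<open>x + 2 f x\<close>, \<open>y + 2 g y\<close>, \<open>z + 2 h z\<close> to \<open>(\<int>/4)\<^sup>n\<close> sum to zero. Let \<open>A\<close>, \<open>B\<close> be the sets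
  of lifts of the first two players, \<open>C\<close> that of negated lifts of the third, and \<open>N = 2\<^sup>n\<close>. The
  number of winning queries is the number of \<open>(a, b) \<in> A \<times> B\<close> with \<open>a + b \<in> C\<close>. For \<open>z \<in> C\<close> let
  \<open>A\<^sub>z = A \<inter> (z - B)\<close>; differences of elements of \<open>A\<^sub>z\<close> tend to have many representations in
  \<open>B - B\<close>. If many queries win, Cauchy--Schwarz gives about \<open>N\<^sup>6\<close> tuples
  \<open>(z, a, a', b, c, b', c')\<close> with entries other than \<open>z\<close> in \<open>A\<^sub>z\<close> and \<open>b - c = b' - c' = d\<close>. Now
  \<open>a - c\<close>, \<open>b - c'\<close>, \<open>b' - a'\<close> are three of about \<open>N\<close> differences, with sum \<open>a + 2 d - a'\<close>. As doubling
  is injective on \<open>A\<close> and kills \<open>2 d\<close>, they determine together with \<open>a'\<close> first \<open>a\<close> and then all other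
  entries; so there are at most about \<open>N \<cdot> N \<cdot> N\<^sup>3 = N\<^sup>5\<close> tuples, a contradiction. All inequalities
  are free of constants, so that the estimate holds for every \<open>n\<close>.\<close>

section \<open>Counting inequalities\<close>

text \<open>Cauchy--Schwarz applied twice. Fourth powers are what \<open>config_count_lower\<close>
  and \<open>multiplicity_power4_le\<close> deal with.\<close>

lemma sum_power4_le:
  fixes f :: "'a \<Rightarrow> real"
  shows "(\<Sum>i\<in>I. f i) ^ 4 \<le> real (card I) ^ 3 * (\<Sum>i\<in>I. f i ^ 4)"
proof -
  have "(\<Sum>i\<in>I. f i) ^ 4 = ((\<Sum>i\<in>I. f i)\<^sup>2)\<^sup>2" by simp
  also have "\<dots> \<le> ((\<Sum>i\<in>I. (f i)\<^sup>2) * card I)\<^sup>2"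
    by (intro power_mono sum_squared_le_sum_of_squares) simp
  also have "\<dots> = (\<Sum>i\<in>I. (f i)\<^sup>2)\<^sup>2 * (card I)\<^sup>2" by (simp add: power_mult_distrib)
  also have "\<dots> \<le> ((\<Sum>i\<in>I. ((f i)\<^sup>2)\<^sup>2) * card I) * (card I)\<^sup>2"
    by (intro mult_right_mono sum_squared_le_sum_of_squares) simp
  also have "\<dots> = real (card I) ^ 3 * (\<Sum>i\<in>I. f i ^ 4)"
    by (simp add: power2_eq_square power3_eq_cube power4_eq_xxxx mult.assoc)
  finally show ?thesis .
qed

text \<open>Cauchy--Schwarz for \<open>sqrt (p i)\<close> and \<open>sqrt (q i)\<close>; the
  pointwise hypothesis in product form keeps square roots out of the applications.\<close>

lemma sum_square_le_mult_sum:
  fixes s p q :: "'a \<Rightarrow> real"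
  assumes "\<And>i. i \<in> I \<Longrightarrow> 0 \<le> p i" "\<And>i. i \<in> I \<Longrightarrow> 0 \<le> q i" "\<And>i. i \<in> I \<Longrightarrow> 0 \<le> s i"
    and "\<And>i. i \<in> I \<Longrightarrow> (s i)\<^sup>2 \<le> p i * q i"
  shows "(\<Sum>i\<in>I. s i)\<^sup>2 \<le> (\<Sum>i\<in>I. p i) * (\<Sum>i\<in>I. q i)"
proof -
  have "(\<Sum>i\<in>I. s i) \<le> (\<Sum>i\<in>I. sqrt (p i) * sqrt (q i))"
    using assms by (intro sum_mono) (metis real_le_rsqrt real_sqrt_mult)
  then have "(\<Sum>i\<in>I. s i)\<^sup>2 \<le> (\<Sum>i\<in>I. sqrt (p i) * sqrt (q i))\<^sup>2"
    using assms by (intro power_mono sum_nonneg)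
  also have "\<dots> \<le> (\<Sum>i\<in>I. (sqrt (p i))\<^sup>2) * (\<Sum>i\<in>I. (sqrt (q i))\<^sup>2)"
    by (rule Cauchy_Schwarz_ineq_sum)
  also have "\<dots> = (\<Sum>i\<in>I. p i) * (\<Sum>i\<in>I. q i)"
    using assms by simp
  finally show ?thesis .
qed

lemma sum_card_swap:
  assumes "finite I" "finite J"
  shows "(\<Sum>i\<in>I. card {j \<in> J. P i j}) = (\<Sum>j\<in>J. card {i \<in> I. P i j})"
  using assms by (intro sum_multicount_gen) auto

section \<open>Representations as differences\<close>

definition rep :: "'k::ab_group_add set \<Rightarrow> 'k \<Rightarrow> real"
  where "rep X t = real (card {p \<in> X \<times> X. fst p - snd p = t})"

text \<open>The cardinality of this set is the additive energy of \<open>X\<close>.\<close>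

definition additive_quads :: "'k::ab_group_add set \<Rightarrow> (('k \<times> 'k) \<times> ('k \<times> 'k)) set"
  where "additive_quads X =
    {pq \<in> (X \<times> X) \<times> (X \<times> X). fst (fst pq) - snd (fst pq) = fst (snd pq) - snd (snd pq)}"

lemma rep_nonneg [simp]: "0 \<le> rep X t"
  by (simp add: rep_def)

lemma rep_le_card:
  assumes "finite X"
  shows "rep X t \<le> card X"
proof -
  have "card {p \<in> X \<times> X. fst p - snd p = t} \<le> card X"
    using assms by (intro card_inj_on_le[where f = fst]) (auto simp: inj_on_def)
  then show ?thesis by (simp add: rep_def)
qed

lemma sum_rep:
  assumes "finite X" "finite D" "\<And>a b. \<lbrakk>a \<in> X; b \<in> X\<rbrakk> \<Longrightarrow> a - b \<in> D"
  shows "(\<Sum>t\<in>D. rep X t) = (real (card X))\<^sup>2"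
proof -
  have "(\<Sum>t\<in>D. sum (\<lambda>_. 1::real) {p \<in> X \<times> X. fst p - snd p = t}) = sum (\<lambda>_. 1) (X \<times> X)"
    using assms by (intro sum.group) auto
  then show ?thesis by (simp add: rep_def card_cartesian_product power2_eq_square)
qed

text \<open>Meant for mixed sums such as \<open>\<Sum>t\<in>diffs. rep B t\<close>, where the
  differences come from another set.\<close>

lemma sum_rep_le:
  assumes "finite X" "finite D"
  shows "(\<Sum>t\<in>D. rep X t) \<le> (real (card X))\<^sup>2"
proof -
  let ?D = "(\<lambda>p. fst p - snd p) ` (X \<times> X) \<union> D"
  have "(\<Sum>t\<in>D. rep X t) \<le> (\<Sum>t\<in>?D. rep X t)"
    using assms by (intro sum_mono2) auto
  also have "\<dots> = (real (card X))\<^sup>2"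
    using assms by (intro sum_rep) force+
  finally show ?thesis .
qed

lemma card_additive_quads:
  assumes "finite X" "finite D" "\<And>a b. \<lbrakk>a \<in> X; b \<in> X\<rbrakk> \<Longrightarrow> a - b \<in> D"
  shows "real (card (additive_quads X)) = (\<Sum>t\<in>D. (rep X t)\<^sup>2)"
proof -
  let ?R = "\<lambda>t. {p \<in> X \<times> X. fst p - snd p = t}"
  let ?g = "\<lambda>pq. fst (fst pq) - snd (fst pq)"
  have fib: "{pq \<in> additive_quads X. ?g pq = t} = ?R t \<times> ?R t" for t
    by (auto simp: additive_quads_def)
  have fin: "finite (additive_quads X)"
    using assms unfolding additive_quads_def by auto
  have "(\<Sum>t\<in>D. sum (\<lambda>_. 1::real) {pq \<in> additive_quads X. ?g pq = t})
      = sum (\<lambda>_. 1) (additive_quads X)"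
    using assms fin by (intro sum.group) (auto simp: additive_quads_def)
  then show ?thesis
    by (simp add: fib rep_def card_cartesian_product power2_eq_square)
qed

text \<open>Three of the four entries determine the last one.\<close>

lemma card_additive_quads_le:
  assumes "finite X"
  shows "card (additive_quads X) \<le> card X ^ 3"
proof -
  have "card (additive_quads X) \<le> card ((X \<times> X) \<times> X)"
    using assms
    by (intro card_inj_on_le[where f = "\<lambda>pq. (fst pq, fst (snd pq))"])
       (auto simp: inj_on_def additive_quads_def)
  then show ?thesis by (simp add: card_cartesian_product power3_eq_cube)
qed

section \<open>Additive triples\<close>

locale additive_triple =
  fixes A B C :: "'k::ab_group_add set" and N :: real
  assumes fin: "finite A" "finite B" "finite C"
    and card_le: "card A \<le> N" "card B \<le> N" "card C \<le> N"
begin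

definition fiber :: "'k \<Rightarrow> 'k set"
  where "fiber z = {a \<in> A. z - a \<in> B}"

definition diffs :: "'k set"
  where "diffs = (\<lambda>p. fst p - snd p) ` (A \<times> A)"

text \<open>The tuples of the overview without \<open>z\<close>: a free pair and an additive
  quadruple. Both the single fibers and the whole of \<open>A\<close> are inserted for
  \<open>Y\<close>.\<close>

definition configs :: "'k set \<Rightarrow> (('k \<times> 'k) \<times> (('k \<times> 'k) \<times> ('k \<times> 'k))) set"
  where "configs Y = (Y \<times> Y) \<times> additive_quads Y"

definition config_count :: real
  where "config_count = (\<Sum>z\<in>C. real (card (configs (fiber z))))"

lemma N_nonneg: "0 \<le> N"
  using card_le(1) of_nat_0_le_iff order_trans by blast

lemma finite_diffs: "finite diffs"
  using fin by (simp add: diffs_def)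

lemma diff_in_diffs: "\<lbrakk>a \<in> A; b \<in> A\<rbrakk> \<Longrightarrow> a - b \<in> diffs"
  by (force simp: diffs_def)

lemma fiber_subset: "fiber z \<subseteq> A"
  by (auto simp: fiber_def)

lemma finite_fiber: "finite (fiber z)"
  using fiber_subset fin finite_subset by blast

lemma card_fiber_le: "card (fiber z) \<le> N"
  using card_mono[OF fin(1) fiber_subset[of z]] card_le(1) by linarith

lemma diff_fiber_in_diffs: "\<lbrakk>a \<in> fiber z; b \<in> fiber z\<rbrakk> \<Longrightarrow> a - b \<in> diffs"
  using fiber_subset diff_in_diffs by blast

text \<open>For each such \<open>z\<close>, both \<open>z - c\<close> and \<open>z - a\<close> lie
  in \<open>B\<close> and their difference is \<open>a - c\<close>. This is the precise sense in
  which differences inside fibers are popular in \<open>B - B\<close>.\<close>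

lemma card_common_le_rep:
  "real (card {z \<in> C. a \<in> fiber z \<and> c \<in> fiber z}) \<le> rep B (a - c)"
proof -
  have "card {z \<in> C. a \<in> fiber z \<and> c \<in> fiber z} \<le> card {p \<in> B \<times> B. fst p - snd p = a - c}"
    using fin
    by (intro card_inj_on_le[where f = "\<lambda>z. (z - c, z - a)"])
       (auto simp: inj_on_def fiber_def)
  then show ?thesis by (simp add: rep_def)
qed

text \<open>Double counting: each of the \<open>rep A t\<close> pairs with difference
  \<open>t\<close> lies in at most \<open>rep B t\<close> fibers.\<close>

lemma sum_rep_fiber_le: "(\<Sum>z\<in>C. rep (fiber z) t) \<le> rep A t * rep B t"
proof -
  let ?R = "{p \<in> A \<times> A. fst p - snd p = t}"
  have "(\<Sum>z\<in>C. card {p \<in> fiber z \<times> fiber z. fst p - snd p = t})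
      = (\<Sum>z\<in>C. card {p \<in> ?R. fst p \<in> fiber z \<and> snd p \<in> fiber z})"
    using fiber_subset by (intro sum.cong refl arg_cong[where f = card]) auto
  also have "\<dots> = (\<Sum>p\<in>?R. card {z \<in> C. fst p \<in> fiber z \<and> snd p \<in> fiber z})"
    using fin by (intro sum_card_swap) auto
  finally have "(\<Sum>z\<in>C. rep (fiber z) t)
      = (\<Sum>p\<in>?R. real (card {z \<in> C. fst p \<in> fiber z \<and> snd p \<in> fiber z}))"
    unfolding rep_def by (metis (no_types, lifting) of_nat_sum sum.cong)
  also have "\<dots> \<le> (\<Sum>p\<in>?R. rep B t)"
    by (intro sum_mono) (use card_common_le_rep in fastforce)
  also have "\<dots> = rep A t * rep B t" by (simp add: rep_def)
  finally show ?thesis .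
qed

section \<open>Lower bound for the number of configurations\<close>

lemma card_configs: "real (card (configs (fiber z))) = (real (card (fiber z)))\<^sup>2 * (\<Sum>t\<in>diffs. (rep (fiber z) t)\<^sup>2)"
  unfolding configs_def
  by (simp add: card_cartesian_product power2_eq_square
      card_additive_quads[OF finite_fiber finite_diffs diff_fiber_in_diffs])

lemma sum_card_fiber_power4:
  "(\<Sum>z\<in>C. real (card (fiber z)) ^ 4) = (\<Sum>t\<in>diffs. \<Sum>z\<in>C. (real (card (fiber z)))\<^sup>2 * rep (fiber z) t)"
proof -
  have "real (card (fiber z)) ^ 4 = (\<Sum>t\<in>diffs. (real (card (fiber z)))\<^sup>2 * rep (fiber z) t)" for z
    using sum_rep[OF finite_fiber[of z] finite_diffs diff_fiber_in_diffs]
    by (simp add: power2_eq_square power4_eq_xxxx mult.assoc flip: sum_distrib_left)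
  then show ?thesis by (simp add: sum.swap[of _ diffs])
qed

text \<open>The first Cauchy--Schwarz step brings in a factor \<open>rep B t\<close>; the second
  trades it for a second factor \<open>rep (fiber z) t\<close>, which produces the energy of the
  fibers. If about \<open>N\<close> fibers have size about \<open>N\<close>, the left side is about
  \<open>N ^ 20\<close>, so \<open>config_count\<close> is at least about
  \<open>N ^ 6\<close>.\<close>

lemma config_count_lower: "(\<Sum>z\<in>C. real (card (fiber z)) ^ 4) ^ 4 \<le> N ^ 14 * config_count"
proof -
  let ?x = "\<lambda>z. real (card (fiber z))"
  define s where "s t = (\<Sum>z\<in>C. (?x z)\<^sup>2 * rep (fiber z) t)" for t
  have s0: "0 \<le> s t" for t by (simp add: s_def sum_nonneg)
  have x2: "(?x z)\<^sup>2 \<le> N\<^sup>2" for z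
    by (intro power_mono card_fiber_le) simp
  have s_le: "s t \<le> N\<^sup>2 * (rep A t * rep B t)" for t
  proof -
    have "s t \<le> (\<Sum>z\<in>C. N\<^sup>2 * rep (fiber z) t)"
      unfolding s_def by (intro sum_mono mult_right_mono x2) simp
    also have "\<dots> \<le> N\<^sup>2 * (rep A t * rep B t)"
      unfolding sum_distrib_left[symmetric] by (intro mult_left_mono sum_rep_fiber_le) simp
    finally show ?thesis .
  qed
  have cardA2: "(real (card A))\<^sup>2 \<le> N\<^sup>2" and cardB2: "(real (card B))\<^sup>2 \<le> N\<^sup>2"
    by (intro power_mono card_le; simp)+
  \<comment> \<open>The pointwise hypothesis is \<open>s_le\<close> multiplied by
    \<open>s t\<close>.\<close>
  have 1: "(\<Sum>t\<in>diffs. s t)\<^sup>2 \<le> (\<Sum>t\<in>diffs. N\<^sup>2 * rep A t) * (\<Sum>t\<in>diffs. s t * rep B t)"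
  proof (rule sum_square_le_mult_sum)
    show "(s t)\<^sup>2 \<le> N\<^sup>2 * rep A t * (s t * rep B t)" for t
      using mult_left_mono[OF s_le[of t] s0[of t]] by (simp add: power2_eq_square mult_ac)
  qed (simp_all add: s0)
  have 2: "(\<Sum>t\<in>diffs. N\<^sup>2 * rep A t) \<le> N ^ 4"
  proof -
    have "(\<Sum>t\<in>diffs. N\<^sup>2 * rep A t) \<le> N\<^sup>2 * N\<^sup>2"
      unfolding sum_distrib_left[symmetric]
      by (intro mult_left_mono order_trans[OF sum_rep_le cardA2] fin finite_diffs) simp
    then show ?thesis by simp
  qed
  have 3: "(\<Sum>t\<in>diffs. s t * rep B t)\<^sup>2 \<le> config_count * N ^ 6"
  proof -
    have "(\<Sum>t\<in>diffs. s t * rep B t)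
        = (\<Sum>(z, t)\<in>C \<times> diffs. (?x z)\<^sup>2 * rep (fiber z) t * rep B t)"
      by (simp add: s_def sum_distrib_right sum.swap[of _ diffs] flip: sum.cartesian_product)
    \<comment> \<open>Each term is split as
      \<open>(?x z * rep (fiber z) t) * (?x z * rep B t)\<close>.\<close>
    also have "\<dots>\<^sup>2 \<le> (\<Sum>(z, t)\<in>C \<times> diffs. (?x z)\<^sup>2 * (rep (fiber z) t)\<^sup>2)
        * (\<Sum>(z, t)\<in>C \<times> diffs. (?x z)\<^sup>2 * (rep B t)\<^sup>2)"
      by (rule sum_square_le_mult_sum) (auto simp: power2_eq_square mult_ac)
    also have "(\<Sum>(z, t)\<in>C \<times> diffs. (?x z)\<^sup>2 * (rep (fiber z) t)\<^sup>2) = config_count"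
      by (simp add: config_count_def card_configs sum_distrib_left flip: sum.cartesian_product)
    also have "(\<Sum>(z, t)\<in>C \<times> diffs. (?x z)\<^sup>2 * (rep B t)\<^sup>2) \<le> N ^ 6"
    proof -
      have "(\<Sum>t\<in>diffs. (rep B t)\<^sup>2) \<le> (\<Sum>t\<in>diffs. N * rep B t)"
        unfolding power2_eq_square
        by (intro sum_mono mult_right_mono order_trans[OF rep_le_card card_le(2)] fin) simp
      also have "\<dots> \<le> N * N\<^sup>2"
        unfolding sum_distrib_left[symmetric]
        by (intro mult_left_mono order_trans[OF sum_rep_le cardB2] fin finite_diffs N_nonneg)
      finally have r: "(\<Sum>t\<in>diffs. (rep B t)\<^sup>2) \<le> N ^ 3" by (simp add: power3_eq_cube power2_eq_square)
      have "(\<Sum>(z, t)\<in>C \<times> diffs. (?x z)\<^sup>2 * (rep B t)\<^sup>2) = (\<Sum>z\<in>C. (?x z)\<^sup>2) * (\<Sum>t\<in>diffs. (rep B t)\<^sup>2)"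
        by (simp add: sum_product flip: sum.cartesian_product)
      also have "\<dots> \<le> (N * N\<^sup>2) * N ^ 3"
      proof (intro mult_mono r)
        have "(\<Sum>z\<in>C. (?x z)\<^sup>2) \<le> card C * N\<^sup>2"
          using sum_bounded_above[of C "\<lambda>z. (?x z)\<^sup>2", OF x2] by simp
        also have "\<dots> \<le> N * N\<^sup>2" by (intro mult_right_mono card_le) simp
        finally show "(\<Sum>z\<in>C. (?x z)\<^sup>2) \<le> N * N\<^sup>2" .
      qed (auto simp: N_nonneg intro: sum_nonneg)
      also have "\<dots> = N ^ 6" by (simp flip: power_Suc power_add)
      finally show ?thesis .
    qed
    finally show ?thesis by (simp add: mult_left_mono config_count_def sum_nonneg)
  qed
  have "(\<Sum>t\<in>diffs. s t) ^ 4 = ((\<Sum>t\<in>diffs. s t)\<^sup>2)\<^sup>2" by simp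
  also have "\<dots> \<le> ((\<Sum>t\<in>diffs. N\<^sup>2 * rep A t) * (\<Sum>t\<in>diffs. s t * rep B t))\<^sup>2"
    by (intro power_mono 1) simp
  also have "\<dots> \<le> (N ^ 4 * (\<Sum>t\<in>diffs. s t * rep B t))\<^sup>2"
    by (intro power_mono mult_right_mono 2) (auto intro!: sum_nonneg mult_nonneg_nonneg simp: s0)
  also have "\<dots> = N ^ 8 * (\<Sum>t\<in>diffs. s t * rep B t)\<^sup>2" by (simp add: power_mult_distrib)
  also have "\<dots> \<le> N ^ 8 * (config_count * N ^ 6)"
    by (intro mult_left_mono 3) (simp add: N_nonneg)
  also have "\<dots> = N ^ 14 * config_count" by (simp flip: power_add)
  finally show ?thesis by (simp add: sum_card_fiber_power4 s_def)
qed

section \<open>Upper bound for the number of configurations\<close>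

fun key :: "('k \<times> 'k) \<times> (('k \<times> 'k) \<times> ('k \<times> 'k)) \<Rightarrow> 'k \<times> ('k \<times> 'k \<times> 'k)"
  where "key ((a, a'), ((b, c), (b', c'))) = (a', (a - c, b - c', b' - a'))"

text \<open>Weighting differences by their representations in \<open>B - B\<close> replaces a
  cut-off at popular differences, which would cost constants.\<close>

fun weight :: "'k \<times> 'k \<times> 'k \<Rightarrow> real"
  where "weight (p, q, r) = rep B p * rep B q * rep B r"

lemma weight_nonneg [simp]: "0 \<le> weight p"
  by (cases p) simp

definition multiplicity :: "('k \<times> 'k) \<times> (('k \<times> 'k) \<times> ('k \<times> 'k)) \<Rightarrow> real"
  where "multiplicity w = real (card {z \<in> C. w \<in> configs (fiber z)})"

lemma multiplicity_nonneg [simp]: "0 \<le> multiplicity w"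
  by (simp add: multiplicity_def)

lemma finite_configs: "finite (configs A)"
  using fin unfolding configs_def additive_quads_def by auto

lemma card_configs_A: "real (card (configs A)) \<le> N ^ 5"
proof -
  have "card (configs A) \<le> (card A * card A) * card A ^ 3"
    unfolding configs_def card_cartesian_product
    by (intro mult_left_mono card_additive_quads_le fin) simp
  also have "\<dots> = card A ^ 5" by (simp add: eval_nat_numeral)
  finally have "real (card (configs A)) \<le> real (card A) ^ 5" by (simp flip: of_nat_power)
  also have "\<dots> \<le> N ^ 5" by (intro power_mono card_le) simp
  finally show ?thesis .
qed

lemma config_count_eq_sum_multiplicity: "config_count = (\<Sum>w\<in>configs A. multiplicity w)"
proof -
  have "configs (fiber z) = {w \<in> configs A. w \<in> configs (fiber z)}" for z
    using fiber_subset[of z] by (auto simp: configs_def additive_quads_def)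
  then have "(\<Sum>z\<in>C. card (configs (fiber z))) = (\<Sum>z\<in>C. card {w \<in> configs A. w \<in> configs (fiber z)})" by simp
  also have "\<dots> = (\<Sum>w\<in>configs A. card {z \<in> C. w \<in> configs (fiber z)})"
    by (intro sum_card_swap fin finite_configs)
  finally show ?thesis unfolding config_count_def multiplicity_def by (metis (no_types, lifting) of_nat_sum sum.cong)
qed

text \<open>The two entries of each difference in \<open>key\<close> lie in every fiber counted, so
  \<open>card_common_le_rep\<close> bounds three of the factors; the fourth is at most
  \<open>card C\<close>.\<close>

lemma multiplicity_power4_le: "multiplicity w ^ 4 \<le> N * weight (snd (key w))"
proof -
  obtain a a' b c b' c' where w: "w = ((a, a'), ((b, c), (b', c')))"
    by (metis prod.collapse)
  have le: "multiplicity w \<le> rep B (u - v)"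
    if "\<And>z. w \<in> configs (fiber z) \<Longrightarrow> u \<in> fiber z \<and> v \<in> fiber z" for u v
  proof -
    have "card {z \<in> C. w \<in> configs (fiber z)} \<le> card {z \<in> C. u \<in> fiber z \<and> v \<in> fiber z}"
      using that fin by (intro card_mono) auto
    then show ?thesis unfolding multiplicity_def using card_common_le_rep[of u v] by linarith
  qed
  have "card {z \<in> C. w \<in> configs (fiber z)} \<le> card C"
    using fin by (intro card_mono) auto
  then have "multiplicity w \<le> N" using card_le(3) unfolding multiplicity_def by linarith
  moreover have "multiplicity w \<le> rep B (a - c)" "multiplicity w \<le> rep B (b - c')" "multiplicity w \<le> rep B (b' - a')"
    by (intro le; simp add: w configs_def additive_quads_def)+
  ultimately have "multiplicity w * (multiplicity w * multiplicity w * multiplicity w) \<le> N * (rep B (a - c) * rep B (b - c') * rep B (b' - a'))"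
    using N_nonneg by (intro mult_mono) auto
  then show ?thesis by (simp add: w eval_nat_numeral mult_ac)
qed

text \<open>If \<open>d = b - c = b' - c'\<close>, then the three differences recorded by \<^term>\<open>key\<close> add up to
  \<open>a + 2 d - a'\<close>. Doubling kills \<open>4 d\<close>, so \<open>a'\<close> and the key determine \<open>a\<close>, then
  \<open>c\<close>, \<open>b'\<close> and \<open>2 d\<close>, and finally \<open>b\<close>.\<close>
lemma inj_on_key:
  assumes exp4: "\<And>k::'k. k + k + k + k = 0"
    and double: "\<And>a b. \<lbrakk>a \<in> A; b \<in> A; a + a = b + b\<rbrakk> \<Longrightarrow> a = b"
  shows "inj_on key (configs A)"
proof (rule inj_onI)
  fix v w assume vw: "v \<in> configs A" "w \<in> configs A" "key v = key w"
  obtain a1 a1' b1 c1 b1' c1' where v: "v = ((a1, a1'), ((b1, c1), (b1', c1')))"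
    by (metis prod.collapse)
  obtain a2 a2' b2 c2 b2' c2' where w: "w = ((a2, a2'), ((b2, c2), (b2', c2')))"
    by (metis prod.collapse)
  define d1 d2 where "d1 = b1 - c1" and "d2 = b2 - c2"
  have A: "a1 \<in> A" "a2 \<in> A" "b1 \<in> A" "b2 \<in> A"
    and q: "b1 - c1 = b1' - c1'" "b2 - c2 = b2' - c2'"
    using vw by (auto simp: v w configs_def additive_quads_def)
  have d1: "b1 = d1 + c1" "b1' = d1 + c1'" and d2: "b2 = d2 + c2" "b2' = d2 + c2'"
    unfolding d1_def d2_def using q by (simp_all flip: diff_eq_eq)
  have a': "a1' = a2'" and k1: "a1 - c1 = a2 - c2" and k2: "b1 - c1' = b2 - c2'"
    and k3: "b1' - a1' = b2' - a2'"
    using vw by (auto simp: v w)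
  from k3 a' have b': "b1' = b2'" by simp
  have "a1 + d1 + d1 = (a1 - c1) + (b1 - c1') + b1'" by (simp add: d1)
  also have "\<dots> = a2 + d2 + d2" unfolding k1 k2 b' by (simp add: d2)
  finally have u: "a1 + d1 + d1 = a2 + d2 + d2" .
  have "a1 + a1 + (d1 + d1 + d1 + d1) = (a1 + d1 + d1) + (a1 + d1 + d1)" by (simp add: ac_simps)
  also have "\<dots> = a2 + a2 + (d2 + d2 + d2 + d2)" unfolding u by (simp add: ac_simps)
  finally have "a1 + a1 = a2 + a2" by (simp only: exp4 add_0_right)
  then have a: "a1 = a2" by (rule double[OF A(1,2)])
  with k1 have c: "c1 = c2" by simp
  have "b1 + b1 = (a1 + d1 + d1) - a1 + c1 + c1" by (simp add: d1 ac_simps)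
  also have "\<dots> = (a2 + d2 + d2) - a2 + c2 + c2" unfolding u by (simp add: a c)
  also have "\<dots> = b2 + b2" by (simp add: d2 ac_simps)
  finally have b: "b1 = b2" by (rule double[OF A(3,4)])
  with k2 have "c1' = c2'" by simp
  with a a' b c b' show "v = w" by (simp add: v w)
qed

text \<open>Injectivity allows passing to a sum over all possible keys, which factors into
  \<open>card A\<close> and three sums of at most \<open>N\<^sup>2\<close> each.\<close>

lemma sum_weight_key:
  assumes "inj_on key (configs A)"
  shows "(\<Sum>w\<in>configs A. weight (snd (key w))) \<le> N ^ 7"
proof -
  have S: "(\<Sum>t\<in>diffs. rep B t) \<le> N\<^sup>2"
    using sum_rep_le[OF fin(2) finite_diffs] power_mono[OF card_le(2), of 2] by simp
  have S0: "0 \<le> (\<Sum>t\<in>diffs. rep B t)" by (simp add: sum_nonneg)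
  have img: "key ` configs A \<subseteq> A \<times> (diffs \<times> diffs \<times> diffs)"
    by (auto simp: configs_def additive_quads_def intro: diff_in_diffs)
  have "(\<Sum>w\<in>configs A. weight (snd (key w))) = (\<Sum>k\<in>key ` configs A. weight (snd k))"
    using sum.reindex[OF assms, of "\<lambda>k. weight (snd k)"] by simp
  also have "\<dots> \<le> (\<Sum>k\<in>A \<times> (diffs \<times> diffs \<times> diffs). weight (snd k))"
    using img fin finite_diffs by (intro sum_mono2) auto
  also have "\<dots> = (\<Sum>a\<in>A. \<Sum>p\<in>diffs. \<Sum>q\<in>diffs. \<Sum>r\<in>diffs. rep B p * rep B q * rep B r)"
    by (simp add: sum.cartesian_product')
  also have "\<dots> = card A * ((\<Sum>t\<in>diffs. rep B t) * ((\<Sum>t\<in>diffs. rep B t) * (\<Sum>t\<in>diffs. rep B t)))"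
    by (simp add: mult.assoc flip: sum_distrib_left sum_distrib_right)
  also have "\<dots> \<le> N * (N\<^sup>2 * (N\<^sup>2 * N\<^sup>2))"
    by (intro mult_mono S card_le S0 N_nonneg mult_nonneg_nonneg) auto
  also have "\<dots> = N ^ 7" by (simp flip: power_Suc power_add)
  finally show ?thesis .
qed

text \<open>The exponent is 3 * 5 from \<open>card_configs_A\<close>, 1 from the factor
  \<open>N\<close> and 7 from \<open>sum_weight_key\<close>. So the count is at most
  \<open>N\<close> to the power 23/4, short of the 6 in the dense case.\<close>

lemma config_count_upper:
  assumes "inj_on key (configs A)"
  shows "config_count ^ 4 \<le> N ^ 23"
proof -
  have "config_count ^ 4 \<le> real (card (configs A)) ^ 3 * (\<Sum>w\<in>configs A. multiplicity w ^ 4)"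
    unfolding config_count_eq_sum_multiplicity by (rule sum_power4_le)
  also have "\<dots> \<le> (N ^ 5) ^ 3 * (\<Sum>w\<in>configs A. N * weight (snd (key w)))"
    by (intro mult_mono power_mono sum_mono card_configs_A multiplicity_power4_le) (auto simp: N_nonneg sum_nonneg)
  also have "\<dots> \<le> (N ^ 5) ^ 3 * (N * N ^ 7)"
    unfolding sum_distrib_left[symmetric]
    by (intro mult_left_mono sum_weight_key assms) (auto simp: N_nonneg)
  also have "\<dots> = N ^ 23" by (simp flip: power_Suc power_add power_mult)
  finally show ?thesis .
qed

text \<open>The trivial bound \<open>N\<^sup>2\<close> on the sum would give exponent 128. Here 3 *
  16 + 14 * 4 + 23 = 127, and this single factor \<open>N\<close> is the whole gain.\<close>

lemma sum_card_fiber_le: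
  assumes "\<And>k::'k. k + k + k + k = 0"
    and "\<And>a b. \<lbrakk>a \<in> A; b \<in> A; a + a = b + b\<rbrakk> \<Longrightarrow> a = b"
  shows "(\<Sum>z\<in>C. real (card (fiber z))) ^ 64 \<le> N ^ 127"
proof -
  let ?L = "\<Sum>z\<in>C. real (card (fiber z)) ^ 4"
  have L0: "0 \<le> ?L" by (simp add: sum_nonneg)
  have "(\<Sum>z\<in>C. real (card (fiber z))) ^ 4 \<le> real (card C) ^ 3 * ?L"
    by (rule sum_power4_le)
  also have "\<dots> \<le> N ^ 3 * ?L"
    by (intro mult_right_mono power_mono card_le L0) simp
  finally have "((\<Sum>z\<in>C. real (card (fiber z))) ^ 4) ^ 16 \<le> (N ^ 3 * ?L) ^ 16"
    by (intro power_mono) simp_all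
  also have "\<dots> = N ^ 48 * (?L ^ 4) ^ 4"
    by (simp add: power_mult_distrib flip: power_mult)
  also have "\<dots> \<le> N ^ 48 * (N ^ 14 * config_count) ^ 4"
    by (intro mult_left_mono power_mono config_count_lower) (auto simp: N_nonneg L0)
  also have "\<dots> = N ^ 104 * config_count ^ 4"
    by (simp add: power_mult_distrib flip: power_mult power_add mult.assoc)
  also have "\<dots> \<le> N ^ 104 * N ^ 23"
    by (intro mult_left_mono config_count_upper inj_on_key[OF assms]) (simp_all add: N_nonneg)
  finally show ?thesis by (simp flip: power_mult power_add)
qed

end

section \<open>Winning queries as additive triples\<close>

text \<open>The type \<open>4\<close> is the ring of integers modulo 4. As \<open>n\<close> cannot
  enter a type, vectors of length \<open>n\<close> are functions vanishing from \<open>n\<close>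
  on.\<close>

definition embed :: "nat \<Rightarrow> (bool list \<Rightarrow> bool list) \<Rightarrow> bool list \<Rightarrow> nat \<Rightarrow> 4"
  where "embed n f x = (\<lambda>i. if i < n then of_bool (x ! i) + 2 * of_bool (f x ! i) else 0)"

lemma exponent4: "k + k + k + k = (0 :: nat \<Rightarrow> 4)"
proof
  fix i
  have "k i + k i + k i + k i = 4 * k i" by simp
  also have "(4 :: 4) = 0" by simp
  finally show "(k + k + k + k) i = (0 :: nat \<Rightarrow> 4) i" by simp
qed

text \<open>Doubling modulo 4 kills the answer bit, which has coefficient 2, and still shows the
  query bit.\<close>

lemma embed_double_inj:
  assumes "x \<in> cube n" "y \<in> cube n" "embed n f x + embed n f x = embed n g y + embed n g y"
  shows "x = y"
proof (rule nth_equalityI)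
  show "length x = length y" using assms by (simp add: cube_def)
  fix i assume "i < length x"
  then have i: "i < n" using assms by (simp add: cube_def)
  have "(embed n f x + embed n f x) i = (embed n g y + embed n g y) i"
    using assms by simp
  then show "x ! i = y ! i"
    using i by (cases "x ! i"; cases "y ! i"; cases "f x ! i"; cases "g y ! i") (simp_all add: embed_def)
qed

text \<open>In each coordinate the query bits add up to twice their disjunction, and on winning the
  answers contribute the same modulo 4.\<close>

lemma embed_sum_eq_0:
  assumes "\<forall>i<n. \<not> (x ! i \<oplus> y ! i \<oplus> z ! i)" "ghz_accepts n f g h x y z"
  shows "embed n f x + embed n g y + embed n h z = 0"
proof
  fix i
  show "(embed n f x + embed n g y + embed n h z) i = (0 :: nat \<Rightarrow> 4) i"
  proof (cases "i < n")
    case True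
    then have "\<not> (x ! i \<oplus> y ! i \<oplus> z ! i)"
      "(f x ! i \<oplus> g y ! i \<oplus> h z ! i) = (x ! i \<or> y ! i \<or> z ! i)"
      using assms by (auto simp: ghz_accepts_def)
    then show ?thesis
      using True
      by (cases "x ! i"; cases "y ! i"; cases "z ! i";
          cases "f x ! i"; cases "g y ! i"; cases "h z ! i") (simp_all add: embed_def)
  qed (simp add: embed_def)
qed

lemma card_cube: "card (cube n) = 2 ^ n"
  using card_lists_length_eq[of "UNIV :: bool set" n] by (simp add: cube_def)

definition winning :: "nat \<Rightarrow> (bool list \<Rightarrow> bool list) \<Rightarrow> (bool list \<Rightarrow> bool list)
    \<Rightarrow> (bool list \<Rightarrow> bool list) \<Rightarrow> (bool \<times> bool \<times> bool) list set"
  where "winning n f g h = {q \<in> lists ghz_queries. length q = n \<and>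
    ghz_accepts n f g h (map fst q) (map (fst \<circ> snd) q) (map (snd \<circ> snd) q)}"

lemma finite_ghz_queries: "finite ghz_queries" and card_ghz_queries: "card ghz_queries = 4"
  by (simp_all add: ghz_queries_eq)

lemma finite_winning: "finite (winning n f g h)"
  by (rule finite_subset[OF _ finite_lists_length_eq[OF finite_ghz_queries, of n]])
     (auto simp: winning_def)

lemma card_winning_power_le:
  "real (card (winning n f g h)) ^ 64 \<le> (2 ^ n) ^ 127"
proof -
  define A B C where "A = embed n f ` cube n" and "B = embed n g ` cube n"
    and "C = (\<lambda>z. - embed n h z) ` cube n"
  interpret additive_triple A B C "2 ^ n"
  proof
    have "card A \<le> 2 ^ n" "card B \<le> 2 ^ n" "card C \<le> 2 ^ n"
      unfolding A_def B_def C_def by (metis card_cube card_image_le finite_cube)+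
    then show "real (card A) \<le> 2 ^ n" "real (card B) \<le> 2 ^ n" "real (card C) \<le> 2 ^ n"
      by (metis of_nat_le_iff of_nat_numeral of_nat_power)+
  qed (simp_all add: A_def B_def C_def finite_cube)
  \<comment> \<open>Bob's query is left out, since parity recovers it from the other two; this is
    what \<open>q\<close> supplies in the injectivity proof.\<close>
  let ?e = "\<lambda>q. (- embed n h (map (snd \<circ> snd) q), embed n f (map fst q))"
  have emb: "x = y" if "embed n f' x = embed n f' y" "x \<in> cube n" "y \<in> cube n" for f' x y
    using embed_double_inj[of x n y f' f'] that by simp
  have q: "\<not> (fst (q ! i) \<oplus> fst (snd (q ! i)) \<oplus> snd (snd (q ! i)))"
    if "q \<in> winning n f g h" "i < n" for q i
  proof -
    have "q ! i \<in> ghz_queries" using that by (auto simp: winning_def)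
    then show ?thesis by (auto simp: ghz_queries_def)
  qed
  have inj: "inj_on ?e (winning n f g h)"
  proof (rule inj_onI)
    fix p q assume pq: "p \<in> winning n f g h" "q \<in> winning n f g h" "?e p = ?e q"
    then have len: "length p = n" "length q = n" by (auto simp: winning_def)
    then have eq: "map fst p = map fst q" "map (snd \<circ> snd) p = map (snd \<circ> snd) q"
      using pq by (auto intro!: emb simp: cube_def)
    show "p = q"
    proof (rule nth_equalityI)
      fix i assume "i < length p"
      then have i: "i < n" "i < length p" "i < length q" using len by auto
      have "map fst p ! i = map fst q ! i" "map (snd \<circ> snd) p ! i = map (snd \<circ> snd) q ! i"
        by (simp_all only: eq)
      then have "fst (p ! i) = fst (q ! i)" "snd (snd (p ! i)) = snd (snd (q ! i))"
        using i by simp_all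
      with q[OF pq(1) i(1)] q[OF pq(2) i(1)] show "p ! i = q ! i"
        by (auto simp: prod_eq_iff)
    qed (simp add: len)
  qed
  have "?e q \<in> Sigma C fiber" if "q \<in> winning n f g h" for q
  proof -
    let ?x = "map fst q" and ?y = "map (fst \<circ> snd) q" and ?z = "map (snd \<circ> snd) q"
    have len: "length q = n" using that by (simp add: winning_def)
    then have cube: "?x \<in> cube n" "?y \<in> cube n" "?z \<in> cube n" by (simp_all add: cube_def)
    have "embed n f ?x + embed n g ?y + embed n h ?z = 0"
      using that q[OF that] len by (intro embed_sum_eq_0) (auto simp: winning_def)
    then have "embed n f ?x + embed n g ?y = - embed n h ?z"
      by (simp only: eq_neg_iff_add_eq_0)
    then have "- embed n h ?z - embed n f ?x = embed n g ?y"
      by (metis add_diff_cancel_left')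
    moreover have "embed n f ?x \<in> A" "embed n g ?y \<in> B" "- embed n h ?z \<in> C"
      using cube by (simp_all add: A_def B_def C_def)
    ultimately show ?thesis by (simp add: fiber_def)
  qed
  then have "card (winning n f g h) \<le> card (Sigma C fiber)"
    using inj fin finite_fiber by (intro card_inj_on_le) auto
  also have "\<dots> = (\<Sum>z\<in>C. card (fiber z))"
    using fin finite_fiber by (intro card_SigmaI) auto
  finally have "real (card (winning n f g h)) \<le> (\<Sum>z\<in>C. real (card (fiber z)))"
    by (simp flip: of_nat_sum)
  then have "real (card (winning n f g h)) ^ 64 \<le> (\<Sum>z\<in>C. real (card (fiber z))) ^ 64"
    by (intro power_mono) simp_all
  also have "\<dots> \<le> (2 ^ n) ^ 127"
  proof (rule sum_card_fiber_le[OF exponent4])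
    show "a = b" if "a \<in> A" "b \<in> A" "a + a = b + b" for a b
      using that embed_double_inj unfolding A_def by (metis imageE)
  qed
  finally show ?thesis .
qed

section \<open>The value of the repeated game\<close>

lemma pmf_ghz_query:
  assumes "q \<in> lists ghz_queries" "length q = n"
  shows "pmf (ghz_query_pmf n) q = 1 / 4 ^ n"
  using assms
proof (induction n arbitrary: q)
  case 0
  then show ?case by (simp add: ghz_query_pmf_def)
next
  case (Suc n)
  then obtain x xs where q: "q = x # xs" "x \<in> ghz_queries" "xs \<in> lists ghz_queries" "length xs = n"
    by (cases q) auto
  let ?p = "pmf_of_set ghz_queries"
  have ne: "ghz_queries \<noteq> {}" by (simp add: ghz_queries_eq)
  \<comment> \<open>As the image of a product distribution under an injective map, the mass
    factors.\<close>
  have "replicate_pmf (Suc n) ?p = map_pmf (\<lambda>(x, xs). x # xs) (pair_pmf ?p (replicate_pmf n ?p))"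
    by (simp add: pair_pmf_def map_bind_pmf bind_return_pmf)
  then have "pmf (ghz_query_pmf (Suc n)) q
      = pmf (map_pmf (\<lambda>(x, xs). x # xs) (pair_pmf ?p (replicate_pmf n ?p))) ((\<lambda>(x, xs). x # xs) (x, xs))"
    by (simp add: ghz_query_pmf_def q)
  also have "\<dots> = pmf ?p x * pmf (replicate_pmf n ?p) xs"
    by (subst pmf_map_inj') (auto simp: inj_def pmf_pair)
  also have "\<dots> = 1 / 4 ^ Suc n"
    using Suc.IH[of xs] q ne by (simp add: ghz_query_pmf_def finite_ghz_queries card_ghz_queries)
  finally show ?case .
qed

lemma ghz_win_prob_eq: "ghz_win_prob n f g h = card (winning n f g h) / 4 ^ n"
proof -
  let ?M = "measure_pmf (ghz_query_pmf n)"
  have "set_pmf (ghz_query_pmf n) = {q \<in> lists ghz_queries. length q = n}"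
    using finite_ghz_queries
    by (simp add: ghz_query_pmf_def set_replicate_pmf set_pmf_of_set ghz_queries_eq)
  \<comment> \<open>The event in \<open>ghz_win_prob\<close> also contains lists outside the
    support, so the two sets agree only almost everywhere.\<close>
  then have "ghz_win_prob n f g h = measure ?M (winning n f g h)"
    unfolding ghz_win_prob_def winning_def
    by (intro measure_pmf.finite_measure_eq_AE) (auto simp: AE_measure_pmf_iff)
  also have "\<dots> = (\<Sum>q\<in>winning n f g h. pmf (ghz_query_pmf n) q)"
    by (rule measure_measure_pmf_finite[OF finite_winning])
  also have "\<dots> = (\<Sum>q\<in>winning n f g h. 1 / 4 ^ n)"
    by (intro sum.cong refl pmf_ghz_query) (auto simp: winning_def)
  finally show ?thesis by simp
qed

text \<open>With \<open>N = 2 ^ n\<close> there are \<open>N\<^sup>2\<close> queries, so the 64th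
  power of the probability is at most \<open>N ^ 127 / N ^ 128\<close>; the 64th root of
  \<open>1 / N\<close> yields the constant 1/64.\<close>

lemma ghz_win_prob_le: "ghz_win_prob n f g h \<le> 2 powr (- (1 / 64) * real n)"
proof -
  have "(4::real) ^ n = (2 ^ n)\<^sup>2"
    by (simp add: power2_eq_square flip: power_mult_distrib)
  then have "ghz_win_prob n f g h ^ 64 = real (card (winning n f g h)) ^ 64 / (2 ^ n) ^ 128"
    by (simp add: ghz_win_prob_eq power_divide flip: power_mult)
  also have "\<dots> \<le> (2 ^ n) ^ 127 / (2 ^ n) ^ 128"
    by (intro divide_right_mono card_winning_power_le) simp
  also have "\<dots> = 1 / 2 ^ n"
    by (simp add: field_simps flip: power_Suc)
  also have "\<dots> = 2 powr (- real n)"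
    by (simp add: powr_minus_divide powr_realpow)
  also have "\<dots> = (2 powr (- (1 / 64) * real n)) ^ 64"
    by (subst powr_power) simp_all
  finally show ?thesis
    by (subst (asm) power_mono_iff) (simp_all add: ghz_win_prob_def)
qed

theorem theorem1p1:
  shows "\<exists>\<epsilon>::real. \<epsilon> > 0 \<and> (\<forall>n::nat. n > 0 \<longrightarrow> ghz_value n \<le> 2 powr (- \<epsilon> * real n))"
proof (intro exI[of _ "1 / 64"] conjI allI impI)
  show "ghz_value n \<le> 2 powr (- (1 / 64) * real n)" for n
    using ghz_value_attained[of n] ghz_win_prob_le by force
qed simp

end
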